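(* Let $(\Phi,G)$ and $(\Psi,H)$ be perception pairs and let $T\colon G\to H$ be a group homomorphism. Let $\mathcal{F}^{\mathrm{all}}_T$ be the set of all GENEOs $(F,T)$ from $(\Phi,G)$ to $(\Psi,H)$ associated with $T$. If $\Phi$ and $\Psi$ are compact (with respect to the uniform metric), then $\mathcal{F}^{\mathrm{all}}_T$ is compact with respect to the metric $$D_{\mathrm{GENEO}}\left((F_1,T),(F_2,T)\right):=\max_{\varphi\in\Phi}\lVert F_1(\varphi)-F_2(\varphi)\rVert_\infty .$$
   Context: Perception pair: let $\Phi$ be a set of bounded functions from a set $X$ to $\mathbb{R}^n$ (for some $n\in\mathbb{N}$), endowed with the uniform metric $\lVert\varphi_1-\varphi_2\rVert_\infty=\sup_{x\in X}\lVert\varphi_1(x)-\varphi_2(x)\rVert_\infty$. $\mathrm{Aut}_\Phi(X)$ is the group (under composition) of all bijections $g\colon X\to X$ such that $\varphi g,\varphi g^{-1}\in\Phi$ for every $\varphi\in\Phi$, where $\varphi g=\varphi\circ g$. A perception pair is a pair $(\Phi,G)$ with $G$ a subgroup of $\mathrm{Aut}_\Phi(X)$; we write $X=\mathrm{dom}(\Phi)$. The functions in $\Psi$ may be defined on a different set $Y=\mathrm{dom}(\Psi)$. GENEO: a pair $(F,T)$ with $F\colon\Phi\to\Psi$ and $T\colon G\to H$ is a Group Equivariant Non-Expansive Operator from $(\Phi,G)$ to $(\Psi,H)$ if $T$ is a group homomorphism, $F(\varphi g)=F(\varphi)T(g)$ for all $\varphi\in\Phi$, $g\in G$, and $\lVert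 F(\varphi_1)-F(\varphi_2)\rVert_\infty\le\lVert\varphi_1-\varphi_2\rVert_\infty$ for all $\varphi_1,\varphi_2\in\Phi$. *)

theory Defs
  imports "HOL-Analysis.Analysis" "HOL-Algebra.Bij"
begin

text \<open>
  Functions on a set \<open>X\<close> are represented by extensional functions, so that equality of
  HOL functions is equality on \<open>X\<close>.  Accordingly, composition of functions on \<open>X\<close> is
  \<^const>\<open>compose\<close> and the group of all bijections of \<open>X\<close> is \<^const>\<open>BijGroup\<close>.
\<close>

definition inf_dist :: "real ^ 'n \<Rightarrow> real ^ 'n \<Rightarrow> real"
  where "inf_dist u v = infnorm (u - v)"

lemma Metric_space_inf_dist: "Metric_space UNIV inf_dist"
proof
  fix x y z :: "real ^ 'n"
  show "inf_dist x z \<le> inf_dist x y + inf_dist y z"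
    unfolding inf_dist_def using infnorm_triangle[of "x - y" "y - z"] by simp
qed (auto simp: inf_dist_def infnorm_pos_le infnorm_sub infnorm_eq_0)

definition bounded_funs :: "'a set \<Rightarrow> ('a \<Rightarrow> real ^ 'n) set"
  where "bounded_funs X = Metric_space.fspace UNIV inf_dist X"

text \<open>
  On \<open>bounded_funs X\<close> this is the supremum over \<open>x \<in> X\<close> of \<open>inf_dist (\<phi>1 x) (\<phi>2 x)\<close>,
  where the supremum over the empty set is \<open>0\<close>.
\<close>

definition unif_dist :: "'a set \<Rightarrow> ('a \<Rightarrow> real ^ 'n) \<Rightarrow> ('a \<Rightarrow> real ^ 'n) \<Rightarrow> real"
  where "unif_dist X = Metric_space.fdist UNIV inf_dist X"

lemma unif_dist_eq:
  assumes "\<phi>1 \<in> bounded_funs X" "\<phi>2 \<in> bounded_funs X"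
  shows "unif_dist X \<phi>1 \<phi>2 = (if X = {} then 0 else SUP x\<in>X. infnorm (\<phi>1 x - \<phi>2 x))"
  using assms
  by (simp add: unif_dist_def bounded_funs_def
      Metric_space.fdist_def[OF Metric_space_inf_dist] inf_dist_def)

lemma bounded_funs_iff:
  "\<phi> \<in> bounded_funs X \<longleftrightarrow> \<phi> \<in> extensional X \<and> (\<exists>B. \<forall>x\<in>X. infnorm (\<phi> x) \<le> B)"
proof -
  have "Metric_space.mbounded UNIV inf_dist S \<longleftrightarrow> (\<exists>B. \<forall>u\<in>S. infnorm u \<le> B)"
    for S :: "(real ^ 'n) set"
  proof
    assume "Metric_space.mbounded UNIV inf_dist S"
    then obtain c B where B: "\<forall>u\<in>S. infnorm (c - u) \<le> B"
      unfolding Metric_space.mbounded_def[OF Metric_space_inf_dist]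
        Metric_space.mcball_def[OF Metric_space_inf_dist] inf_dist_def by auto
    have "infnorm u \<le> infnorm c + B" if "u \<in> S" for u
      using infnorm_triangle[of c "u - c"] B that infnorm_sub[of c u] by fastforce
    then show "\<exists>B. \<forall>u\<in>S. infnorm u \<le> B" by blast
  next
    assume "\<exists>B. \<forall>u\<in>S. infnorm u \<le> B"
    then obtain B where B: "\<forall>u\<in>S. infnorm u \<le> B" by blast
    then have "S \<subseteq> Metric_space.mcball UNIV inf_dist 0 B"
      unfolding Metric_space.mcball_def[OF Metric_space_inf_dist] inf_dist_def
      by (auto simp: infnorm_neg)
    then show "Metric_space.mbounded UNIV inf_dist S"
      unfolding Metric_space.mbounded_def[OF Metric_space_inf_dist] by blast
  qed
  then show ?thesis
    by (auto simp: bounded_funs_def Metric_space.fspace_def[OF Metric_space_inf_dist])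
qed

lemma Metric_space_unif_dist: "\<Phi> \<subseteq> bounded_funs X \<Longrightarrow> Metric_space \<Phi> (unif_dist X)"
  unfolding bounded_funs_def unif_dist_def
  by (rule Metric_space.subspace[OF Metric_space.Metric_space_funspace[OF Metric_space_inf_dist]])

definition Aut_dom :: "'a set \<Rightarrow> ('a \<Rightarrow> real ^ 'n) set \<Rightarrow> ('a \<Rightarrow> 'a) set"
  where "Aut_dom X \<Phi> =
    {g \<in> Bij X. \<forall>\<phi>\<in>\<Phi>. compose X \<phi> g \<in> \<Phi> \<and> compose X \<phi> (restrict (inv_into X g) X) \<in> \<Phi>}"

abbreviation perm_group :: "'a set \<Rightarrow> ('a \<Rightarrow> 'a) set \<Rightarrow> ('a \<Rightarrow> 'a) monoid"
  where "perm_group X G \<equiv> (BijGroup X)\<lparr>carrier := G\<rparr>"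

definition perception_pair ::
    "'a set \<Rightarrow> ('a \<Rightarrow> real ^ 'n) set \<Rightarrow> ('a \<Rightarrow> 'a) set \<Rightarrow> bool"
  where "perception_pair X \<Phi> G \<longleftrightarrow>
    \<Phi> \<subseteq> bounded_funs X \<and> subgroup G (perm_group X (Aut_dom X \<Phi>))"

lemma inv_BijGroup_eq:
  assumes "g \<in> Bij X"
  shows "inv\<^bsub>BijGroup X\<^esub> g = restrict (inv_into X g) X"
proof (rule group.inv_equality[OF group_BijGroup])
  show "restrict (inv_into X g) X \<otimes>\<^bsub>BijGroup X\<^esub> g = \<one>\<^bsub>BijGroup X\<^esub>"
    using assms restrict_inv_into_Bij[OF assms]
    by (simp add: BijGroup_def Bij_compose_restrict_eq)
qed (use assms restrict_inv_into_Bij[OF assms] in \<open>auto simp: BijGroup_def\<close>)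

lemma subgroup_Aut_dom:
  assumes "\<Phi> \<subseteq> bounded_funs X"
  shows "subgroup (Aut_dom X \<Phi>) (BijGroup X)"
proof -
  interpret group "BijGroup X" by (rule group_BijGroup)
  have carr: "carrier (BijGroup X) = Bij X" by (simp add: BijGroup_def)
  have Aut_iff: "g \<in> Aut_dom X \<Phi> \<longleftrightarrow> g \<in> Bij X \<and>
      (\<forall>\<phi>\<in>\<Phi>. compose X \<phi> g \<in> \<Phi> \<and> compose X \<phi> (inv\<^bsub>BijGroup X\<^esub> g) \<in> \<Phi>)" for g
    by (auto simp: Aut_dom_def inv_BijGroup_eq)
  have comp: "compose X \<phi> (g \<otimes>\<^bsub>BijGroup X\<^esub> h) = compose X (compose X \<phi> g) h"
    if "g \<in> Bij X" "h \<in> Bij X" for \<phi> :: "'a \<Rightarrow> real ^ 'b" and g h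
    using that by (auto simp: BijGroup_def compose_def fun_eq_iff Bij_imp_funcset[THEN funcset_mem])
  show ?thesis
  proof
    show "Aut_dom X \<Phi> \<subseteq> carrier (BijGroup X)" by (auto simp: carr Aut_dom_def)
  next
    fix g h assume "g \<in> Aut_dom X \<Phi>" "h \<in> Aut_dom X \<Phi>"
    then show "g \<otimes>\<^bsub>BijGroup X\<^esub> h \<in> Aut_dom X \<Phi>"
      using m_closed[of g h] inv_closed[of g] inv_closed[of h]
      by (simp add: Aut_iff comp carr inv_mult_group)
  next
    have "compose X \<phi> (\<one>\<^bsub>BijGroup X\<^esub>) = \<phi>" if "\<phi> \<in> \<Phi>" for \<phi>
    proof -
      have "\<phi> \<in> extensional X" using assms that by (auto simp: bounded_funs_iff)
      then show ?thesis
        by (auto simp: BijGroup_def compose_def fun_eq_iff extensional_def)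
    qed
    then show "\<one>\<^bsub>BijGroup X\<^esub> \<in> Aut_dom X \<Phi>"
      using one_closed by (simp add: Aut_iff carr)
  next
    fix g assume "g \<in> Aut_dom X \<Phi>"
    then show "inv\<^bsub>BijGroup X\<^esub> g \<in> Aut_dom X \<Phi>"
      using inv_closed[of g] by (simp add: Aut_iff carr)
  qed
qed

definition GENEO ::
    "'a set \<Rightarrow> ('a \<Rightarrow> real ^ 'n) set \<Rightarrow> ('a \<Rightarrow> 'a) set \<Rightarrow>
     'b set \<Rightarrow> ('b \<Rightarrow> real ^ 'm) set \<Rightarrow> ('b \<Rightarrow> 'b) set \<Rightarrow>
     (('a \<Rightarrow> real ^ 'n) \<Rightarrow> ('b \<Rightarrow> real ^ 'm)) \<times> (('a \<Rightarrow> 'a) \<Rightarrow> ('b \<Rightarrow> 'b)) \<Rightarrow> bool"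
  where "GENEO X \<Phi> G Y \<Psi> H = (\<lambda>(F, T).
    F \<in> \<Phi> \<rightarrow>\<^sub>E \<Psi> \<and>
    T \<in> hom (perm_group X G) (perm_group Y H) \<and>
    (\<forall>\<phi>\<in>\<Phi>. \<forall>g\<in>G. F (compose X \<phi> g) = compose Y (F \<phi>) (T g)) \<and>
    (\<forall>\<phi>1\<in>\<Phi>. \<forall>\<phi>2\<in>\<Phi>. unif_dist Y (F \<phi>1) (F \<phi>2) \<le> unif_dist X \<phi>1 \<phi>2))"

definition F_all ::
    "'a set \<Rightarrow> ('a \<Rightarrow> real ^ 'n) set \<Rightarrow> ('a \<Rightarrow> 'a) set \<Rightarrow>
     'b set \<Rightarrow> ('b \<Rightarrow> real ^ 'm) set \<Rightarrow> ('b \<Rightarrow> 'b) set \<Rightarrow> (('a \<Rightarrow> 'a) \<Rightarrow> ('b \<Rightarrow> 'b)) \<Rightarrow>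
     ((('a \<Rightarrow> real ^ 'n) \<Rightarrow> ('b \<Rightarrow> real ^ 'm)) \<times> (('a \<Rightarrow> 'a) \<Rightarrow> ('b \<Rightarrow> 'b))) set"
  where "F_all X \<Phi> G Y \<Psi> H T = {(F, T) | F. GENEO X \<Phi> G Y \<Psi> H (F, T)}"

text \<open>
  \<^const>\<open>Greatest\<close> is the maximum of a possibly infinite set (\<^const>\<open>Max\<close> is meaningful only
  for finite sets); it is unspecified unless the maximum is attained.  The maximum over an empty
  \<open>\<Phi>\<close> is \<open>0\<close>.  The value \<open>0\<close> outside \<open>F_all\<close> is needed because the
  locale \<^locale>\<open>Metric_space\<close> demands nonnegativity and symmetry also outside the carrier.
\<close>

definition D_GENEO ::
    "'a set \<Rightarrow> ('a \<Rightarrow> real ^ 'n) set \<Rightarrow> ('a \<Rightarrow> 'a) set \<Rightarrow>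
     'b set \<Rightarrow> ('b \<Rightarrow> real ^ 'm) set \<Rightarrow> ('b \<Rightarrow> 'b) set \<Rightarrow> (('a \<Rightarrow> 'a) \<Rightarrow> ('b \<Rightarrow> 'b)) \<Rightarrow>
     (('a \<Rightarrow> real ^ 'n) \<Rightarrow> ('b \<Rightarrow> real ^ 'm)) \<times> (('a \<Rightarrow> 'a) \<Rightarrow> ('b \<Rightarrow> 'b)) \<Rightarrow>
     (('a \<Rightarrow> real ^ 'n) \<Rightarrow> ('b \<Rightarrow> real ^ 'm)) \<times> (('a \<Rightarrow> 'a) \<Rightarrow> ('b \<Rightarrow> 'b)) \<Rightarrow> real"
  where "D_GENEO X \<Phi> G Y \<Psi> H T p q =
    (if p \<in> F_all X \<Phi> G Y \<Psi> H T \<and> q \<in> F_all X \<Phi> G Y \<Psi> H T \<and> \<Phi> \<noteq> {}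
     then GREATEST d. d \<in> (\<lambda>\<phi>. unif_dist Y (fst p \<phi>) (fst q \<phi>)) ` \<Phi>
     else 0)"

end

theory Submission
  imports Defs
begin

text \<open>
  By Tychonoff, the product topology on \<open>\<Phi> \<rightarrow>\<^sub>E \<Psi>\<close> is compact, and nonexpansivity and
  equivariance are closed conditions on \<open>F\<close> because each of them involves \<open>F\<close> at two points
  only.  On nonexpansive maps pointwise closeness on a finite \<open>\<epsilon>/3\<close>-net of \<open>\<Phi>\<close> forces uniform
  closeness, so the product topology is at least as fine as the topology of \<open>D_GENEO\<close>, and the
  latter inherits compactness.
\<close>

section \<open>Nonexpansive maps between two metric spaces\<close>

text \<open>Extensionality of the maps places this set inside the topspace of the product topology
  on \<open>M1 \<rightarrow>\<^sub>E M2\<close>, where its closedness is to be shown.\<close>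

definition nonexpansive_maps ::
    "'a set \<Rightarrow> ('a \<Rightarrow> 'a \<Rightarrow> real) \<Rightarrow> 'b set \<Rightarrow> ('b \<Rightarrow> 'b \<Rightarrow> real) \<Rightarrow> ('a \<Rightarrow> 'b) set"
  where "nonexpansive_maps M1 d1 M2 d2 =
    {F \<in> M1 \<rightarrow>\<^sub>E M2. \<forall>x\<in>M1. \<forall>y\<in>M1. d2 (F x) (F y) \<le> d1 x y}"

lemma (in Metric_space) continuous_map_dist:
  assumes "continuous_map X mtopology f" "continuous_map X mtopology g"
  shows "continuous_map X euclideanreal (\<lambda>x. d (f x) (g x))"
  using continuous_map_mdist[of X Self f g] assms by (simp add: mtopology_of_def)

lemma closedin_Collect_ball:
  assumes "\<And>i. i \<in> I \<Longrightarrow> closedin X {x \<in> topspace X. P i x}"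
  shows "closedin X {x \<in> topspace X. \<forall>i\<in>I. P i x}"
proof -
  \<comment> \<open>Inserting \<open>topspace X\<close> keeps the family nonempty, so the
    intersection is the right set even for empty \<open>I\<close>.\<close>
  have "closedin X (\<Inter> (insert (topspace X) ((\<lambda>i. {x \<in> topspace X. P i x}) ` I)))"
    using assms by (intro closedin_Inter) auto
  also have "\<dots> = {x \<in> topspace X. \<forall>i\<in>I. P i x}"
    by auto
  finally show ?thesis .
qed

context Metric_space12
begin

lemma nonexpansive_maps_funcset:
  "F \<in> nonexpansive_maps M1 d1 M2 d2 \<Longrightarrow> x \<in> M1 \<Longrightarrow> F x \<in> M2"
  by (auto simp: nonexpansive_maps_def)

text \<open>The radius \<epsilon> is its own modulus of continuity. Extensionality of
  \<open>F\<close> is not assumed, so that the lemma applies to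
  \<open>\<lambda>\<psi>. compose Y \<psi> h\<close>.\<close>

lemma nonexpansive_imp_continuous_map:
  assumes "F \<in> M1 \<rightarrow> M2"
    and "\<And>x y. x \<in> M1 \<Longrightarrow> y \<in> M1 \<Longrightarrow> d2 (F x) (F y) \<le> d1 x y"
  shows "continuous_map M1.mtopology M2.mtopology F"
  unfolding M2.continuous_map_to_metric
proof (intro ballI allI impI)
  fix x \<epsilon> assume x: "x \<in> topspace M1.mtopology" and "(0::real) < \<epsilon>"
  moreover have "F y \<in> M2.mball (F x) \<epsilon>" if "y \<in> M1.mball x \<epsilon>" for y
    using that assms(1) assms(2)[of x y] by auto
  ultimately show "\<exists>U. openin M1.mtopology U \<and> x \<in> U \<and> (\<forall>y\<in>U. F y \<in> M2.mball (F x) \<epsilon>)"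
    by (intro exI[of _ "M1.mball x \<epsilon>"]) auto
qed

text \<open>A continuous real function on a nonempty compact space has a maximum. This gives the
  \<open>GREATEST\<close> in \<open>D_GENEO\<close> a specified value.\<close>

lemma nonexpansive_dist_attains_sup:
  assumes "compact_space M1.mtopology" "M1 \<noteq> {}"
    and "F \<in> nonexpansive_maps M1 d1 M2 d2" "F' \<in> nonexpansive_maps M1 d1 M2 d2"
  shows "\<exists>x\<in>M1. \<forall>y\<in>M1. d2 (F y) (F' y) \<le> d2 (F x) (F' x)"
proof -
  have "continuous_map M1.mtopology M2.mtopology F" "continuous_map M1.mtopology M2.mtopology F'"
    using assms(3,4) by (auto simp: nonexpansive_maps_def intro!: nonexpansive_imp_continuous_map)
  then have "continuous_map M1.mtopology euclideanreal (\<lambda>x. d2 (F x) (F' x))"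
    by (rule M2.continuous_map_dist)
  then have "compactin euclideanreal ((\<lambda>x. d2 (F x) (F' x)) ` M1)"
    using assms(1) by (intro image_compactin[of M1.mtopology]) (auto simp: compact_space_def)
  then have "compact ((\<lambda>x. d2 (F x) (F' x)) ` M1)"
    by simp
  from compact_attains_sup[OF this] assms(2) show ?thesis
    by auto
qed

text \<open>For fixed \<open>x\<close> and \<open>y\<close> the condition is the preimage of a
  closed half-line under a map built from two product projections and \<open>d2\<close>, hence
  closed.\<close>

lemma closedin_nonexpansive_maps:
  "closedin (product_topology (\<lambda>_. M2.mtopology) M1) (nonexpansive_maps M1 d1 M2 d2)"
proof -
  let ?P = "product_topology (\<lambda>_. M2.mtopology) M1"
  have "closedin ?P {F \<in> topspace ?P. d2 (F x) (F y) \<in> {..d1 x y}}" if "x \<in> M1" "y \<in> M1" for x y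
    using that
    by (intro closedin_continuous_map_preimage[of _ euclideanreal] M2.continuous_map_dist
        continuous_map_product_projection) auto
  then have "closedin ?P {F \<in> topspace ?P. \<forall>x\<in>M1. \<forall>y\<in>M1. d2 (F x) (F y) \<in> {..d1 x y}}"
    by (intro closedin_Collect_ball)
  also have "\<dots> = nonexpansive_maps M1 d1 M2 d2"
    by (auto simp: nonexpansive_maps_def)
  finally show ?thesis .
qed

text \<open>Go from \<open>F x\<close> to \<open>F s\<close>, \<open>F' s\<close> and
  \<open>F' x\<close> for a net point \<open>s\<close> near \<open>x\<close>: nonexpansivity bounds
  the outer steps, closeness on the net the middle one.\<close>

lemma nonexpansive_dist_less_if_net:
  assumes "F \<in> nonexpansive_maps M1 d1 M2 d2" "F' \<in> nonexpansive_maps M1 d1 M2 d2"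
    and "K \<subseteq> M1" "M1 \<subseteq> (\<Union>s\<in>K. M1.mball s (\<epsilon> / 3))"
    and "\<And>s. s \<in> K \<Longrightarrow> d2 (F s) (F' s) < \<epsilon> / 3" and "x \<in> M1"
  shows "d2 (F x) (F' x) < \<epsilon>"
proof -
  obtain s where s: "s \<in> K" "s \<in> M1" "d1 s x < \<epsilon> / 3"
    using assms(3,4,6) by auto
  note in_M2 = assms(1,2)[THEN nonexpansive_maps_funcset]
  have "d2 (F x) (F s) \<le> d1 s x" "d2 (F' s) (F' x) \<le> d1 s x"
    using assms(1,2,6) s M1.commute by (auto simp: nonexpansive_maps_def)
  moreover have "d2 (F x) (F' x) \<le> d2 (F x) (F s) + d2 (F s) (F' x)"
    "d2 (F s) (F' x) \<le> d2 (F s) (F' s) + d2 (F' s) (F' x)"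
    using in_M2 assms(6) s by (auto intro!: M2.triangle)
  ultimately show ?thesis
    using assms(5)[OF s(1)] s(3) by linarith
qed

end

section \<open>Precomposition with an admissible bijection\<close>

text \<open>The supremum on the left runs over the points \<open>h y\<close>, all of which lie in
  \<open>Y\<close>.\<close>

lemma unif_dist_compose_le:
  assumes "\<psi>1 \<in> bounded_funs Y" "\<psi>2 \<in> bounded_funs Y"
    and "compose Y \<psi>1 h \<in> bounded_funs Y" "compose Y \<psi>2 h \<in> bounded_funs Y" "h \<in> Y \<rightarrow> Y"
  shows "unif_dist Y (compose Y \<psi>1 h) (compose Y \<psi>2 h) \<le> unif_dist Y \<psi>1 \<psi>2"
proof (cases "Y = {}")
  case False
  obtain B1 B2 where B: "\<And>y. y \<in> Y \<Longrightarrow> infnorm (\<psi>1 y) \<le> B1" "\<And>y. y \<in> Y \<Longrightarrow> infnorm (\<psi>2 y) \<le> B2"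
    using assms(1,2) unfolding bounded_funs_iff by blast
  have "infnorm (\<psi>1 y - \<psi>2 y) \<le> B1 + B2" if "y \<in> Y" for y
    using infnorm_triangle[of "\<psi>1 y" "- \<psi>2 y"] B[OF that] by (simp add: infnorm_neg)
  \<comment> \<open>The supremum of reals is an upper bound only for sets bounded above; this is
    where boundedness of the functions enters.\<close>
  then have bdd: "bdd_above ((\<lambda>y. infnorm (\<psi>1 y - \<psi>2 y)) ` Y)"
    by (rule bdd_aboveI2)
  have "(SUP y\<in>Y. infnorm (compose Y \<psi>1 h y - compose Y \<psi>2 h y))
      \<le> (SUP y\<in>Y. infnorm (\<psi>1 y - \<psi>2 y))"
    using False assms(5)
    by (intro cSUP_least) (auto simp: compose_eq intro!: cSUP_upper[OF _ bdd])
  then show ?thesis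
    using assms False by (simp add: unif_dist_eq)
qed (use assms in \<open>simp add: unif_dist_eq\<close>)

lemma perception_pair_imp_subset_Aut_dom:
  assumes "perception_pair X \<Phi> G"
  shows "G \<subseteq> Aut_dom X \<Phi>"
  using assms subgroup.subset unfolding perception_pair_def by fastforce

text \<open>Precomposition with \<open>h\<close> maps \<Psi> to itself without increasing distances.
  It makes the right side of the equivariance equation continuous in \<open>F\<close>.\<close>

lemma continuous_map_compose_Aut_dom:
  assumes "\<Psi> \<subseteq> bounded_funs Y" "h \<in> Aut_dom Y \<Psi>"
  shows "continuous_map (Metric_space.mtopology \<Psi> (unif_dist Y))
    (Metric_space.mtopology \<Psi> (unif_dist Y)) (\<lambda>\<psi>. compose Y \<psi> h)"
proof -
  interpret Metric_space12 \<Psi> "unif_dist Y" \<Psi> "unif_dist Y"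
    using Metric_space_unif_dist[OF assms(1)] by (simp add: Metric_space12_def)
  have "compose Y \<psi> h \<in> \<Psi>" if "\<psi> \<in> \<Psi>" for \<psi>
    using assms(2) that by (auto simp: Aut_dom_def)
  moreover have "h \<in> Y \<rightarrow> Y"
    using assms(2) by (auto simp: Aut_dom_def dest: Bij_imp_funcset)
  ultimately show ?thesis
    using assms(1) by (intro nonexpansive_imp_continuous_map unif_dist_compose_le) auto
qed

section \<open>The metric space of GENEOs and its compactness\<close>

theorem theorem12:
  fixes X :: "'a set" and \<Phi> :: "('a \<Rightarrow> real ^ 'n) set" and G :: "('a \<Rightarrow> 'a) set"
    and Y :: "'b set" and \<Psi> :: "('b \<Rightarrow> real ^ 'm) set" and H :: "('b \<Rightarrow> 'b) set"
    and T :: "('a \<Rightarrow> 'a) \<Rightarrow> ('b \<Rightarrow> 'b)"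
  assumes "perception_pair X \<Phi> G"
    and "perception_pair Y \<Psi> H"
    and "T \<in> hom (perm_group X G) (perm_group Y H)"
    and "compact_space (Metric_space.mtopology \<Phi> (unif_dist X))"
    and "compact_space (Metric_space.mtopology \<Psi> (unif_dist Y))"
  shows "Metric_space (F_all X \<Phi> G Y \<Psi> H T) (D_GENEO X \<Phi> G Y \<Psi> H T) \<and>
    compact_space (Metric_space.mtopology (F_all X \<Phi> G Y \<Psi> H T) (D_GENEO X \<Phi> G Y \<Psi> H T))"
proof -
  have sub: "\<Phi> \<subseteq> bounded_funs X" "\<Psi> \<subseteq> bounded_funs Y"
    using assms(1,2) by (auto simp: perception_pair_def)
  interpret S: Metric_space12 \<Phi> "unif_dist X" \<Psi> "unif_dist Y"
    using sub[THEN Metric_space_unif_dist] by (simp add: Metric_space12_def)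
  let ?N = "nonexpansive_maps \<Phi> (unif_dist X) \<Psi> (unif_dist Y)"
  let ?A = "F_all X \<Phi> G Y \<Psi> H T"
  let ?D = "D_GENEO X \<Phi> G Y \<Psi> H T"
  let ?P = "product_topology (\<lambda>_. S.M2.mtopology) \<Phi>"
  \<comment> \<open>Dropping the common component \<open>T\<close> turns \<open>?A\<close> into a
    set of functions, to which the product topology applies.\<close>
  define K where "K = {F \<in> ?N. \<forall>\<phi>\<in>\<Phi>. \<forall>g\<in>G. F (compose X \<phi> g) = compose Y (F \<phi>) (T g)}"
  have A_eq: "?A = (\<lambda>F. (F, T)) ` K"
    using assms(3) by (auto simp: F_all_def GENEO_def K_def nonexpansive_maps_def)
  have K_sub: "K \<subseteq> ?N" by (auto simp: K_def)

  \<comment> \<open>This replaces the \<open>GREATEST\<close> in \<open>D_GENEO\<close> by a point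
    of attainment and a bound at every point. Empty \<Phi> is excluded, since there the value is 0
    by convention.\<close>
  have D_attained: "\<exists>\<phi>\<in>\<Phi>. ?D (F, T) (F', T) = unif_dist Y (F \<phi>) (F' \<phi>) \<and>
      (\<forall>\<phi>'\<in>\<Phi>. unif_dist Y (F \<phi>') (F' \<phi>') \<le> ?D (F, T) (F', T))"
    if F: "F \<in> K" "F' \<in> K" and "\<Phi> \<noteq> {}" for F F'
  proof -
    obtain \<phi> where \<phi>: "\<phi> \<in> \<Phi>" "\<forall>\<phi>'\<in>\<Phi>. unif_dist Y (F \<phi>') (F' \<phi>') \<le> unif_dist Y (F \<phi>) (F' \<phi>)"
      using S.nonexpansive_dist_attains_sup[OF assms(4) \<open>\<Phi> \<noteq> {}\<close>] F K_sub by blast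
    then have "?D (F, T) (F', T) = unif_dist Y (F \<phi>) (F' \<phi>)"
      using F \<open>\<Phi> \<noteq> {}\<close> by (auto simp: D_GENEO_def A_eq intro!: Greatest_equality)
    with \<phi> show ?thesis by metis
  qed

  have metric: "Metric_space ?A ?D"
  proof
    fix p q
    show "0 \<le> ?D p q"
    proof (cases "p \<in> ?A \<and> q \<in> ?A \<and> \<Phi> \<noteq> {}")
      case True
      then obtain F F' where "p = (F, T)" "q = (F', T)" "F \<in> K" "F' \<in> K"
        by (auto simp: A_eq)
      then show ?thesis
        using D_attained[of F F'] True by (metis S.M2.nonneg)
    qed (auto simp: D_GENEO_def)
    show "?D p q = ?D q p"
      by (simp add: D_GENEO_def S.M2.commute conj_commute)
  next
    fix p q assume "p \<in> ?A" "q \<in> ?A"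
    then obtain F F' where pq: "p = (F, T)" "q = (F', T)" and F: "F \<in> K" "F' \<in> K"
      by (auto simp: A_eq)
    have ext: "F \<in> \<Phi> \<rightarrow>\<^sub>E \<Psi>" "F' \<in> \<Phi> \<rightarrow>\<^sub>E \<Psi>"
      using F by (auto simp: K_def nonexpansive_maps_def)
    show "(?D p q = 0) = (p = q)"
    proof (cases "\<Phi> = {}")
      \<comment> \<open>Over an empty \<Phi> there is only one extensional function, so
        \<open>F = F'\<close>.\<close>
      case True
      then show ?thesis using ext by (simp add: D_GENEO_def pq)
    next
      case False
      from D_attained[OF F False] obtain \<phi>
        where \<phi>: "\<phi> \<in> \<Phi>" "?D p q = unif_dist Y (F \<phi>) (F' \<phi>)"
          "\<And>\<phi>'. \<phi>' \<in> \<Phi> \<Longrightarrow> unif_dist Y (F \<phi>') (F' \<phi>') \<le> ?D p q"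
        unfolding pq by blast
      have "F = F'" if "?D p q = 0"
      proof (rule PiE_ext[OF ext])
        fix \<phi>' assume "\<phi>' \<in> \<Phi>"
        then have "unif_dist Y (F \<phi>') (F' \<phi>') = 0"
          using \<phi>(3)[of \<phi>'] that by (simp add: order_antisym)
        then show "F \<phi>' = F' \<phi>'"
          using ext \<open>\<phi>' \<in> \<Phi>\<close> by (metis S.M2.zero PiE_mem)
      qed
      moreover have "?D p q = 0" if "F = F'"
        using \<phi>(1,2) that ext by (metis S.M2.mdist_zero PiE_mem)
      ultimately show ?thesis by (auto simp: pq)
    qed
  next
    fix p q r assume "p \<in> ?A" "q \<in> ?A" "r \<in> ?A"
    then obtain F F' F'' where pqr: "p = (F, T)" "q = (F', T)" "r = (F'', T)"
      and F: "F \<in> K" "F' \<in> K" "F'' \<in> K"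
      by (auto simp: A_eq)
    show "?D p r \<le> ?D p q + ?D q r"
    proof (cases "\<Phi> = {}")
      case False
      from D_attained[OF F(1,3) False] obtain \<phi>
        where \<phi>: "\<phi> \<in> \<Phi>" "?D p r = unif_dist Y (F \<phi>) (F'' \<phi>)"
        unfolding pqr by blast
      have "unif_dist Y (F \<phi>) (F'' \<phi>) \<le> unif_dist Y (F \<phi>) (F' \<phi>) + unif_dist Y (F' \<phi>) (F'' \<phi>)"
        using F \<phi>(1) K_sub S.nonexpansive_maps_funcset by (intro S.M2.triangle) blast+
      moreover have "unif_dist Y (F \<phi>) (F' \<phi>) \<le> ?D p q" "unif_dist Y (F' \<phi>) (F'' \<phi>) \<le> ?D q r"
        using D_attained[OF F(1,2) False] D_attained[OF F(2,3) False] \<phi>(1) unfolding pqr by blast+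
      ultimately show ?thesis using \<phi>(2) by linarith
    qed (simp add: D_GENEO_def)
  qed
  interpret A: Metric_space ?A ?D by (rule metric)

  have "compact_space ?P"
    using assms(5) by (simp add: compact_space_product_topology)
  moreover have "closedin ?P K"
  proof -
    \<comment> \<open>Each equivariance equation is the equalizer of two continuous maps into a
      Hausdorff space, hence closed.\<close>
    let ?E = "\<lambda>\<phi> g. {F \<in> topspace ?P. F (compose X \<phi> g) = compose Y (F \<phi>) (T g)}"
    have "closedin ?P (?E \<phi> g)" if "\<phi> \<in> \<Phi>" "g \<in> G" for \<phi> g
    proof (rule closedin_continuous_maps_eq[OF S.M2.Hausdorff_space_mtopology])
      have "compose X \<phi> g \<in> \<Phi>"
        using that perception_pair_imp_subset_Aut_dom[OF assms(1)] by (auto simp: Aut_dom_def)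
      then show "continuous_map ?P S.M2.mtopology (\<lambda>F. F (compose X \<phi> g))"
        by (rule continuous_map_product_projection)
      have "T g \<in> Aut_dom Y \<Psi>"
        using that assms(3) perception_pair_imp_subset_Aut_dom[OF assms(2)] by (auto simp: hom_def)
      from continuous_map_compose[OF continuous_map_product_projection[OF that(1)]
          continuous_map_compose_Aut_dom[OF sub(2) this]]
      show "continuous_map ?P S.M2.mtopology (\<lambda>F. compose Y (F \<phi>) (T g))"
        by (simp add: comp_def)
    qed
    then have "closedin ?P (?N \<inter> {F \<in> topspace ?P. \<forall>\<phi>\<in>\<Phi>. \<forall>g\<in>G.
        F (compose X \<phi> g) = compose Y (F \<phi>) (T g)})"
      by (intro closedin_Int S.closedin_nonexpansive_maps closedin_Collect_ball)
    also have "\<dots> = K"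
      by (auto simp: K_def nonexpansive_maps_def)
    finally show ?thesis .
  qed
  ultimately have compact_K: "compactin ?P K"
    by (rule closedin_compact_space)

  \<comment> \<open>Only this direction is required: compactness passes to the image of
    \<open>K\<close>, which is all of \<open>?A\<close>.\<close>
  have "continuous_map (subtopology ?P K) A.mtopology (\<lambda>F. (F, T))"
    unfolding A.continuous_map_to_metric
  proof (intro ballI allI impI)
    fix F and \<epsilon> :: real assume "F \<in> topspace (subtopology ?P K)" and \<epsilon>: "0 < \<epsilon>"
    then have F: "F \<in> K" by auto
    have "S.M1.mtotally_bounded \<Phi>"
      using assms(4) by (simp add: S.M1.compact_space_eq_mcomplete_mtotally_bounded)
    then obtain Z where Z: "finite Z" "Z \<subseteq> \<Phi>" "\<Phi> \<subseteq> (\<Union>s\<in>Z. S.M1.mball s (\<epsilon> / 3))"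
      using \<epsilon> unfolding S.M1.mtotally_bounded_def by (metis zero_less_divide_iff zero_less_numeral)
    \<comment> \<open>Closeness to \<open>F\<close> at the finitely many net points is open in the
      product topology. The factor \<open>topspace ?P\<close> covers empty \<open>Z\<close>, where
      the indexed intersection is the whole type.\<close>
    define U where "U =
      (\<Inter>s\<in>Z. {F' \<in> topspace ?P. F' s \<in> S.M2.mball (F s) (\<epsilon> / 3)}) \<inter> topspace ?P"
    have "openin ?P {F' \<in> topspace ?P. F' s \<in> S.M2.mball (F s) (\<epsilon> / 3)}" if "s \<in> Z" for s
      using that Z(2) S.M2.openin_mball
      by (intro openin_continuous_map_preimage[of _ S.M2.mtopology]
          continuous_map_product_projection) auto
    then have "openin ?P U"
      unfolding U_def using Z(1) by (intro openin_INT)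
    moreover have "F \<in> U"
    proof -
      have FE: "F \<in> \<Phi> \<rightarrow>\<^sub>E \<Psi>" using F by (simp add: K_def nonexpansive_maps_def)
      then have "F s \<in> \<Psi>" if "s \<in> Z" for s using that Z(2) by auto
      with FE \<epsilon> show ?thesis by (auto simp: U_def)
    qed
    moreover have "(F', T) \<in> A.mball (F, T) \<epsilon>" if F': "F' \<in> U \<inter> K" for F'
    proof -
      have near: "unif_dist Y (F s) (F' s) < \<epsilon> / 3" if "s \<in> Z" for s
        using F' that by (auto simp: U_def)
      have "?D (F, T) (F', T) < \<epsilon>"
      proof (cases "\<Phi> = {}")
        case False
        have "F' \<in> K" using F' by simp
        \<comment> \<open>As the maximum is attained, the strict bound at one \<phi> is a strict
          bound on \<open>?D\<close>.\<close>
        from D_attained[OF F this False] obtain \<phi>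
          where "\<phi> \<in> \<Phi>" "?D (F, T) (F', T) = unif_dist Y (F \<phi>) (F' \<phi>)" by blast
        then show ?thesis
          using S.nonexpansive_dist_less_if_net[of F F' Z \<epsilon> \<phi>] F \<open>F' \<in> K\<close> K_sub Z(2,3) near
          by auto
      qed (use \<epsilon> in \<open>simp add: D_GENEO_def\<close>)
      moreover have "(F, T) \<in> ?A" "(F', T) \<in> ?A"
        using F F' by (auto simp: A_eq)
      ultimately show ?thesis by simp
    qed
    ultimately show "\<exists>V. openin (subtopology ?P K) V \<and> F \<in> V \<and>
        (\<forall>F'\<in>V. (F', T) \<in> A.mball (F, T) \<epsilon>)"
      using F by (intro exI[of _ "U \<inter> K"]) (auto simp: openin_subtopology)
  qed
  moreover have "compactin (subtopology ?P K) K"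
    using compact_K by (simp add: compactin_subtopology)
  ultimately have "compactin A.mtopology ?A"
    using image_compactin[of "subtopology ?P K" K A.mtopology "\<lambda>F. (F, T)"] by (simp only: A_eq)
  with metric show ?thesis
    by (simp add: compact_space_def)
qed

end
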